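(* Let $X$ be a complex Banach space with dual space $X^{*}$. Then $X^{*}$ is uniformly smooth if and only if the following condition holds: for all sequences $(x_n)_{n\ge 0}$, $(y_n)_{n\ge 0}$ in $S_X$ and all $a^{*}\in S_{X^{*}}$ such that $\langle x_n,a^{*}\rangle\to 1$ and $\langle y_n,a^{*}\rangle\to 1$ as $n\to+\infty$, one has $\|x_n-y_n\|_X\to 0$ as $n\to+\infty$.
   Context: For a Banach space $Y$, $B_Y$ denotes its closed unit ball, $S_Y$ its unit sphere, and $\langle y,y^{*}\rangle$ the duality pairing between $y\in Y$ and $y^{*}\in Y^{*}$. Terminology of the paper (not the usual modulus-of-smoothness notion): a Banach space $Y$ is said to be uniformly smooth if for every $y\in S_Y$ there is a unique point $y^{*}\in S_{Y^{*}}$ with the following property: for every $\varepsilon>0$ there exists $\delta>0$ such that if $g\in B_{Y^{*}}$ satisfies $\langle y,g\rangle>1-\delta$, then $\|y^{*}-g\|<\varepsilon$. When the scalars are complex, the inequality $\langle y,g\rangle>1-\delta$ means that $\langle y,g\rangle$ is a real number and is greater than $1-\delta$. Here the definition is applied with $Y=X^{*}$, so that $Y^{*}=X^{**}$. *)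

theory Defs
  imports "HOL-Analysis.Analysis"
begin

section \<open>Complex normed and Banach spaces\<close>

text \<open>The real structure of a complex normed space is the restriction of scalars of the complex
  one. In particular \<open>1 *\<^sub>C x = x\<close> follows from the corresponding law for \<open>(*\<^sub>R)\<close>.\<close>

class complex_normed_vector = real_normed_vector +
  fixes scaleC :: "complex \<Rightarrow> 'a \<Rightarrow> 'a" (infixr "*\<^sub>C" 75)
  assumes scaleC_add_right: "c *\<^sub>C (x + y) = c *\<^sub>C x + c *\<^sub>C y"
    and scaleC_add_left: "(c + d) *\<^sub>C x = c *\<^sub>C x + d *\<^sub>C x"
    and scaleC_scaleC: "c *\<^sub>C d *\<^sub>C x = (c * d) *\<^sub>C x"
    and scaleR_scaleC: "r *\<^sub>R x = complex_of_real r *\<^sub>C x"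
    and norm_scaleC: "norm (c *\<^sub>C x) = cmod c * norm x"

class complex_banach = complex_normed_vector + banach

instantiation complex :: complex_banach
begin

definition scaleC_complex :: "complex \<Rightarrow> complex \<Rightarrow> complex"
  where "scaleC_complex = (*)"

instance
  by standard (simp_all add: scaleC_complex_def algebra_simps norm_mult scaleR_conv_of_real)

end

section \<open>The dual space\<close>

text \<open>The dual consists of the complex-linear bounded functionals, as a subspace of the bounded
  real-linear maps into the complex numbers, whose operator norm it inherits.\<close>

typedef (overloaded) 'a dual =
  "{f :: 'a::complex_normed_vector \<Rightarrow>\<^sub>L complex.
     \<forall>c x. blinfun_apply f (c *\<^sub>C x) = c * blinfun_apply f x}"
  morphisms blinfun_of_dual Abs_dual
  by (rule exI[of _ 0]) simp

setup_lifting type_definition_dual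

definition pairing :: "'a::complex_normed_vector \<Rightarrow> 'a dual \<Rightarrow> complex"
  where "pairing x f = blinfun_apply (blinfun_of_dual f) x"

instantiation dual :: (complex_normed_vector) complex_normed_vector
begin

lift_definition zero_dual :: "'a dual" is 0 by simp

lift_definition plus_dual :: "'a dual \<Rightarrow> 'a dual \<Rightarrow> 'a dual" is "(+)"
  by (simp add: blinfun.add_left algebra_simps)

lift_definition minus_dual :: "'a dual \<Rightarrow> 'a dual \<Rightarrow> 'a dual" is "(-)"
  by (simp add: blinfun.diff_left algebra_simps)

lift_definition uminus_dual :: "'a dual \<Rightarrow> 'a dual" is uminus
  by (simp add: blinfun.minus_left)

lift_definition scaleR_dual :: "real \<Rightarrow> 'a dual \<Rightarrow> 'a dual" is "(*\<^sub>R)"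
  by (simp add: blinfun.scaleR_left)

lift_definition scaleC_dual :: "complex \<Rightarrow> 'a dual \<Rightarrow> 'a dual"
  is "\<lambda>c f. blinfun_mult_right c o\<^sub>L f"
  by simp

lift_definition norm_dual :: "'a dual \<Rightarrow> real" is norm .

definition dist_dual :: "'a dual \<Rightarrow> 'a dual \<Rightarrow> real"
  where "dist_dual f g = norm (f - g)"

definition sgn_dual :: "'a dual \<Rightarrow> 'a dual"
  where "sgn_dual f = inverse (norm f) *\<^sub>R f"

definition uniformity_dual :: "('a dual \<times> 'a dual) filter"
  where "uniformity_dual = (INF e\<in>{0<..}. principal {(f, g). dist f g < e})"

definition open_dual :: "'a dual set \<Rightarrow> bool"
  where "open_dual U = (\<forall>f\<in>U. \<forall>\<^sub>F (f', g) in uniformity. f' = f \<longrightarrow> g \<in> U)"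

instance
proof
  fix f g h :: "'a dual" and r s :: real and c d :: complex and U :: "'a dual set"
  show "f + g + h = f + (g + h)" "f + g = g + f" "0 + f = f" "- f + f = 0" "f - g = f + - g"
    by (transfer, simp)+
  show "r *\<^sub>R (f + g) = r *\<^sub>R f + r *\<^sub>R g" "(r + s) *\<^sub>R f = r *\<^sub>R f + s *\<^sub>R f"
    "r *\<^sub>R s *\<^sub>R f = (r * s) *\<^sub>R f" "1 *\<^sub>R f = f"
    by (transfer, simp add: algebra_simps)+
  show "dist f g = norm (f - g)" by (rule dist_dual_def)
  show "sgn f = inverse (norm f) *\<^sub>R f" by (rule sgn_dual_def)
  show "(uniformity :: ('a dual \<times> 'a dual) filter)
      = (INF e\<in>{0<..}. principal {(f, g). dist f g < e})"
    by (rule uniformity_dual_def)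
  show "open U = (\<forall>f\<in>U. \<forall>\<^sub>F (f', g) in uniformity. f' = f \<longrightarrow> g \<in> U)"
    by (rule open_dual_def)
  show "(norm f = 0) = (f = 0)" by (transfer, simp)
  show "norm (f + g) \<le> norm f + norm g" by (transfer, rule norm_triangle_ineq)
  show "norm (r *\<^sub>R f) = \<bar>r\<bar> * norm f" by (transfer, simp)
  show "c *\<^sub>C (f + g) = c *\<^sub>C f + c *\<^sub>C g"
    by (transfer, rule blinfun_eqI) (simp add: blinfun.add_left algebra_simps)
  show "(c + d) *\<^sub>C f = c *\<^sub>C f + d *\<^sub>C f"
    by (transfer, rule blinfun_eqI) (simp add: blinfun.add_left algebra_simps)
  show "c *\<^sub>C d *\<^sub>C f = (c * d) *\<^sub>C f"
    by (transfer, rule blinfun_eqI) (simp add: algebra_simps)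
  show "r *\<^sub>R f = complex_of_real r *\<^sub>C f"
    by (transfer, rule blinfun_eqI) (simp add: blinfun.scaleR_left scaleR_conv_of_real)
  show "norm (c *\<^sub>C f) = cmod c * norm f"
  proof transfer
    fix c :: complex and f :: "'a \<Rightarrow>\<^sub>L complex"
    have "norm (blinfun_mult_right c o\<^sub>L f) = onorm (\<lambda>x. cmod c *\<^sub>R blinfun_apply f x)"
      by (simp add: norm_blinfun.rep_eq onorm_def norm_mult)
    also have "\<dots> = cmod c * norm f"
      by (simp only: scaleR_blinfun.rep_eq[symmetric] norm_blinfun.rep_eq[symmetric] norm_scaleR
          abs_norm_cancel)
    finally show "norm (blinfun_mult_right c o\<^sub>L f) = cmod c * norm f" .
  qed
qed

end

instance dual :: (complex_normed_vector) complex_banach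
proof
  fix F :: "nat \<Rightarrow> 'a dual"
  assume F: "Cauchy F"
  have dist: "dist f g = dist (blinfun_of_dual f) (blinfun_of_dual g)" for f g :: "'a dual"
    by (simp add: dist_norm norm_dual.rep_eq minus_dual.rep_eq)
  have "Cauchy (\<lambda>n. blinfun_of_dual (F n))"
    using F by (simp add: Cauchy_def dist)
  then obtain l where l: "(\<lambda>n. blinfun_of_dual (F n)) \<longlonglongrightarrow> l"
    by (auto simp: Cauchy_convergent_iff convergent_def)
  have "blinfun_apply l (c *\<^sub>C x) = c * blinfun_apply l x" for c x
  proof (rule LIMSEQ_unique)
    show "(\<lambda>n. blinfun_apply (blinfun_of_dual (F n)) (c *\<^sub>C x)) \<longlonglongrightarrow> blinfun_apply l (c *\<^sub>C x)"
      by (intro tendsto_intros l)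
    have "(\<lambda>n. c * blinfun_apply (blinfun_of_dual (F n)) x) \<longlonglongrightarrow> c * blinfun_apply l x"
      by (intro tendsto_intros l)
    then show "(\<lambda>n. blinfun_apply (blinfun_of_dual (F n)) (c *\<^sub>C x)) \<longlonglongrightarrow> c * blinfun_apply l x"
      using blinfun_of_dual[of "F _"] by simp
  qed
  then have "blinfun_of_dual (Abs_dual l) = l"
    by (simp add: Abs_dual_inverse)
  then have "F \<longlonglongrightarrow> Abs_dual l"
    using l by (simp add: tendsto_iff dist)
  then show "convergent F" by (rule convergentI)
qed

section \<open>Uniform smoothness\<close>

text \<open>This is not the usual notion of uniform smoothness via the modulus of smoothness; in
  particular \<open>\<delta>\<close> may depend on the point \<open>y\<close>. The inequality \<open>pairing y g > 1 - \<delta>\<close> between complex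
  numbers means that the left-hand side is real and satisfies it.\<close>

definition uniformly_smooth :: "'a::complex_banach itself \<Rightarrow> bool" where
  "uniformly_smooth _ \<longleftrightarrow>
    (\<forall>y \<in> sphere (0 :: 'a) 1. \<exists>!y'. y' \<in> sphere (0 :: 'a dual) 1 \<and>
      (\<forall>\<epsilon>>0. \<exists>\<delta>>0. \<forall>g \<in> cball (0 :: 'a dual) 1.
         pairing y g \<in> \<real> \<and> Re (pairing y g) > 1 - \<delta> \<longrightarrow> norm (y' - g) < \<epsilon>))"

end

theory Submission
  imports Defs
begin

text \<open>
  Fix a unit functional \<open>a\<close>. Both sides of the equivalence say that slices of a unit ball cut off by
  \<open>a\<close> near its supremum are small: uniform smoothness speaks of slices of the ball of the bidual, the
  condition on sequences of slices of the ball of \<open>X\<close>. Three facts connect them.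

  Firstly, the canonical map into the bidual is an isometry (\<open>norm_canonical\<close>). So if all slices of the
  bidual ball shrink to a point \<open>\<phi>\<close>, then two unit sequences on which \<open>a\<close> tends to \<open>1\<close> have images that
  converge to \<open>\<phi>\<close>, and their difference tends to zero. Since a slice only contains points at which
  the value of \<open>a\<close> is real, the sequences are first multiplied by unimodular scalars tending to \<open>1\<close>
  (\<open>canonical_tendsto_smooth_point\<close>). The isometry rests on the Hahn-Banach theorem, which is obtained
  here from Zorn's lemma: a pointwise minimal sublinear functional is linear.

  Secondly, the sequential condition forces the slices of the ball of \<open>X\<close> to have diameter tending to
  zero (\<open>small_slices\<close>). By completeness they then shrink to a point \<open>x\<close> at which \<open>a\<close> takes the
  value \<open>1\<close> (\<open>norm_attained\<close>).

  Thirdly, by Goldstine's theorem a slice of the bidual ball is no further from the image of \<open>x\<close> than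
  the corresponding slice of the ball of \<open>X\<close> is from \<open>x\<close> (\<open>bidual_slice_small\<close>). To compare an
  element \<open>g\<close> of the slice with \<open>x\<close> at one functional \<open>f\<close>, it is enough to find a point of the ball of
  \<open>X\<close> that imitates \<open>g\<close> at \<open>a\<close> and at \<open>f\<close>. This only requires separating a point from a convex set
  in \<open>\<complex>\<^sup>2\<close> (\<open>goldstine_two_functionals\<close>). Hence the image of \<open>x\<close> is the point required by uniform
  smoothness. It is the only one, because it belongs to every slice.
\<close>

section \<open>Linear functionals as minimal sublinear functionals\<close>

definition sublinear :: "('a::real_vector \<Rightarrow> real) \<Rightarrow> bool" where
  "sublinear p \<longleftrightarrow> (\<forall>x y. p (x + y) \<le> p x + p y) \<and> (\<forall>r\<ge>0. \<forall>x. p (r *\<^sub>R x) = r * p x)"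

lemma sublinear_add: "sublinear p \<Longrightarrow> p (x + y) \<le> p x + p y"
  and sublinear_scaleR: "sublinear p \<Longrightarrow> 0 \<le> r \<Longrightarrow> p (r *\<^sub>R x) = r * p x"
  by (auto simp: sublinear_def)

lemma sublinear_0: "sublinear p \<Longrightarrow> p 0 = 0"
  using sublinear_scaleR[of p 0 0] by simp

lemma sublinear_ge_minus: "sublinear p \<Longrightarrow> - p (- x) \<le> p x"
  using sublinear_add[of p x "- x"] sublinear_0[of p] by simp

lemma sublinear_norm: "sublinear (norm :: 'a::real_normed_vector \<Rightarrow> real)"
  by (simp add: sublinear_def norm_triangle_ineq)

text \<open>Positive homogeneity only has to be checked as an inequality, because \<open>r\<close> can be replaced by
  its inverse.\<close>

lemma sublinearI:
  assumes add: "\<And>x y. p (x + y) \<le> p x + p y"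
    and zero: "p 0 = 0"
    and scale: "\<And>r x. 0 < r \<Longrightarrow> p (r *\<^sub>R x) \<le> r * p x"
  shows "sublinear p"
proof -
  have "p (r *\<^sub>R x) = r * p x" if "0 \<le> r" for r x
  proof (cases "r = 0")
    case False
    with that have r: "0 < r" by simp
    have "p (inverse r *\<^sub>R r *\<^sub>R x) \<le> inverse r * p (r *\<^sub>R x)"
      using r by (intro scale) simp
    with r have "r * p x \<le> p (r *\<^sub>R x)"
      by (simp add: field_simps)
    with scale[OF r] show ?thesis by (simp add: antisym)
  qed (simp add: zero)
  with add show ?thesis by (simp add: sublinear_def)
qed

text \<open>The infimum over \<open>t \<ge> 0\<close> of \<open>p (z + t y) - t p y\<close> is the largest sublinear functional below
  \<open>p\<close> whose value at \<open>- y\<close> is at most \<open>- p y\<close>. Applied to a minimal \<open>p\<close> it shows that \<open>p\<close> is odd;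
  applied to the norm it forces linear functionals below the result to attain the norm at \<open>y\<close>.\<close>

lemma sublinear_decrease:
  assumes p: "sublinear p"
  obtains q where "sublinear q" "q \<le> p" "q (- y) \<le> - p y"
proof -
  define S where "S z = (\<lambda>t. p (z + t *\<^sub>R y) - t * p y) ` {0..}" for z
  define q where "q z = Inf (S z)" for z
  have lower: "- p (- z) \<le> s" if s: "s \<in> S z" for s z
  proof -
    obtain t where t: "0 \<le> t" "s = p (z + t *\<^sub>R y) - t * p y"
      using s by (auto simp: S_def)
    have "p ((z + t *\<^sub>R y) + (- z)) \<le> p (z + t *\<^sub>R y) + p (- z)"
      by (rule sublinear_add[OF p])
    with t show ?thesis by (simp add: sublinear_scaleR[OF p])
  qed
  have ne: "S z \<noteq> {}" for z by (auto simp: S_def)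
  have bdd: "bdd_below (S z)" for z
    by (rule bdd_belowI) (rule lower)
  have q_le: "q z \<le> p (z + t *\<^sub>R y) - t * p y" if "0 \<le> t" for z t
    unfolding q_def using that by (intro cInf_lower bdd) (auto simp: S_def)
  have le_q: "c \<le> q z" if "\<And>t. 0 \<le> t \<Longrightarrow> c \<le> p (z + t *\<^sub>R y) - t * p y" for c z
    unfolding q_def using that by (intro cInf_greatest ne) (auto simp: S_def)
  have "sublinear q"
  proof (rule sublinearI)
    fix a b
    have "q (a + b) - (p (b + s *\<^sub>R y) - s * p y) \<le> q a" if s: "0 \<le> s" for s
    proof (rule le_q)
      fix t :: real assume t: "0 \<le> t"
      have "q (a + b) \<le> p ((a + b) + (t + s) *\<^sub>R y) - (t + s) * p y"
        using s t by (intro q_le) simp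
      also have "(a + b) + (t + s) *\<^sub>R y = (a + t *\<^sub>R y) + (b + s *\<^sub>R y)"
        by (simp add: algebra_simps)
      also have "p ((a + t *\<^sub>R y) + (b + s *\<^sub>R y)) \<le> p (a + t *\<^sub>R y) + p (b + s *\<^sub>R y)"
        by (rule sublinear_add[OF p])
      finally show "q (a + b) - (p (b + s *\<^sub>R y) - s * p y) \<le> p (a + t *\<^sub>R y) - t * p y"
        by (simp add: algebra_simps)
    qed
    then have "q (a + b) - q a \<le> q b"
      by (intro le_q) (simp add: algebra_simps)
    then show "q (a + b) \<le> q a + q b" by simp
  next
    have "0 \<le> q 0" by (rule le_q) (simp add: sublinear_scaleR[OF p])
    with q_le[of 0 0] show "q 0 = 0" by (simp add: sublinear_0[OF p])
  next
    fix r :: real and z assume r: "0 < r"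
    have "q (r *\<^sub>R z) / r \<le> q z"
    proof (rule le_q)
      fix t :: real assume t: "0 \<le> t"
      have "q (r *\<^sub>R z) \<le> p (r *\<^sub>R z + (r * t) *\<^sub>R y) - (r * t) * p y"
        using r t by (intro q_le) simp
      also have "r *\<^sub>R z + (r * t) *\<^sub>R y = r *\<^sub>R (z + t *\<^sub>R y)"
        by (simp add: algebra_simps)
      also have "p (r *\<^sub>R (z + t *\<^sub>R y)) = r * p (z + t *\<^sub>R y)"
        using r by (simp add: sublinear_scaleR[OF p])
      finally show "q (r *\<^sub>R z) / r \<le> p (z + t *\<^sub>R y) - t * p y"
        using r by (simp add: field_simps)
    qed
    with r show "q (r *\<^sub>R z) \<le> r * q z" by (simp add: field_simps)
  qed
  moreover have "q \<le> p"
    using q_le[of 0] by (simp add: le_fun_def)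
  moreover have "q (- y) \<le> - p y"
    using q_le[of 1 "- y"] by (simp add: sublinear_0[OF p])
  ultimately show ?thesis by (rule that)
qed

text \<open>A sublinear functional that is odd is linear, and oddness is what \<open>sublinear_decrease\<close> gives when
  nothing lies strictly below \<open>p\<close>.\<close>

lemma minimal_sublinear_imp_linear:
  assumes p: "sublinear p"
    and min: "\<And>q. sublinear q \<Longrightarrow> q \<le> p \<Longrightarrow> q = p"
  shows "linear p"
proof -
  have minus: "p (- y) = - p y" for y
  proof -
    obtain q where "sublinear q" "q \<le> p" "q (- y) \<le> - p y"
      using sublinear_decrease[OF p] .
    with min have "p (- y) \<le> - p y" by blast
    with sublinear_ge_minus[OF p, of y] show ?thesis by simp
  qed
  show ?thesis
  proof (rule linearI)
    fix x y
    have "p (- x + - y) \<le> p (- x) + p (- y)" by (rule sublinear_add[OF p])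
    then have "p x + p y \<le> p (x + y)"
      using minus[of "x + y"] by (simp add: minus)
    with sublinear_add[OF p, of x y] show "p (x + y) = p x + p y" by simp
  next
    fix r :: real and x
    show "p (r *\<^sub>R x) = r *\<^sub>R p x"
    proof (cases "0 \<le> r")
      case False
      then have "p ((- r) *\<^sub>R (- x)) = - r * p (- x)"
        by (intro sublinear_scaleR[OF p]) simp
      then show ?thesis by (simp add: minus)
    qed (simp add: sublinear_scaleR[OF p])
  qed
qed

text \<open>The pointwise infimum of a chain is finite because every member is bounded below at \<open>z\<close> by
  \<open>- p0 (- z)\<close>. It is subadditive because two members of a chain can be replaced by the smaller one.\<close>

lemma sublinear_Inf_chain:
  assumes sub: "\<And>p. p \<in> C \<Longrightarrow> sublinear p"
    and chain: "\<And>p q. p \<in> C \<Longrightarrow> q \<in> C \<Longrightarrow> p \<le> q \<or> q \<le> p"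
    and p0: "p0 \<in> C"
  obtains q where "sublinear q" "\<And>p. p \<in> C \<Longrightarrow> q \<le> p"
proof -
  define q where "q z = (INF p\<in>C. p z)" for z
  have lower: "- p0 (- z) \<le> p z" if "p \<in> C" for p z
    using chain[OF p0 that]
  proof
    assume "p0 \<le> p"
    with sublinear_ge_minus[OF sub[OF p0], of z] show ?thesis
      using le_funD[of p0 p z] by simp
  next
    assume "p \<le> p0"
    with sublinear_ge_minus[OF sub[OF that], of z] show ?thesis
      using le_funD[of p p0 "- z"] by simp
  qed
  have q_le: "q z \<le> p z" if "p \<in> C" for p z
    unfolding q_def by (rule cINF_lower[OF bdd_belowI2 that]) (rule lower)
  have le_q: "c \<le> q z" if "\<And>p. p \<in> C \<Longrightarrow> c \<le> p z" for c z
    unfolding q_def using p0 that by (intro cINF_greatest) auto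
  have "sublinear q"
  proof (rule sublinearI)
    fix a b
    have split: "q (a + b) \<le> p a + p' b" if pp: "p \<in> C" "p' \<in> C" for p p'
      using chain[OF pp]
    proof
      assume "p \<le> p'"
      then have "p b \<le> p' b" by (rule le_funD)
      with q_le[OF pp(1), of "a + b"] sublinear_add[OF sub[OF pp(1)], of a b] show ?thesis
        by simp
    next
      assume "p' \<le> p"
      then have "p' a \<le> p a" by (rule le_funD)
      with q_le[OF pp(2), of "a + b"] sublinear_add[OF sub[OF pp(2)], of a b] show ?thesis
        by simp
    qed
    have "q (a + b) - p b \<le> q a" if "p \<in> C" for p
      using split[OF _ that] by (intro le_q) (simp add: algebra_simps)
    then have "q (a + b) - q a \<le> q b"
      by (intro le_q) (simp add: algebra_simps)
    then show "q (a + b) \<le> q a + q b" by simp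
  next
    have "0 \<le> q 0" by (rule le_q) (simp add: sublinear_0[OF sub])
    with q_le[OF p0, of 0] show "q 0 = 0" by (simp add: sublinear_0[OF sub[OF p0]])
  next
    fix r :: real and z assume r: "0 < r"
    have "q (r *\<^sub>R z) / r \<le> q z"
      using r q_le[of _ "r *\<^sub>R z"] by (intro le_q) (simp add: field_simps sublinear_scaleR[OF sub])
    with r show "q (r *\<^sub>R z) \<le> r * q z" by (simp add: field_simps)
  qed
  with q_le show ?thesis by (intro that[of q]) (auto simp: le_fun_def)
qed

lemma exists_linear_below_sublinear:
  assumes p: "sublinear p"
  obtains u where "linear u" "u \<le> p"
proof -
  define A where "A = {q. sublinear q \<and> q \<le> p}"
  \<comment> \<open>Zorn's lemma provides maximal elements, so the order is reversed.\<close>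
  define R where "R = {(q, q'). q \<in> A \<and> q' \<in> A \<and> q' \<le> q}"
  have po: "Partial_order R"
    by (auto simp: R_def partial_order_on_def preorder_on_def refl_on_def trans_def antisym_def
        Field_def)
  have field: "Field R = A" by (auto simp: R_def Field_def)
  have "\<exists>b\<in>Field R. \<forall>q\<in>C. (q, b) \<in> R" if C: "C \<in> Chains R" for C
  proof (cases "C = {}")
    case True
    with p show ?thesis by (auto simp: field A_def)
  next
    case False
    then obtain p0 where p0: "p0 \<in> C" by blast
    have CA: "C \<subseteq> A" using C by (auto simp: Chains_def R_def)
    obtain q where q: "sublinear q" "\<And>p. p \<in> C \<Longrightarrow> q \<le> p"
    proof (rule sublinear_Inf_chain[of C p0])
      show "sublinear p" if "p \<in> C" for p using that CA by (auto simp: A_def)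
      show "p \<le> q \<or> q \<le> p" if "p \<in> C" "q \<in> C" for p q
        using that C by (auto simp: Chains_def R_def)
    qed (use p0 in auto)
    have "q \<in> A" using q p0 CA by (force simp: A_def intro: order_trans)
    with q(2) CA show ?thesis unfolding field by (intro bexI[of _ q]) (auto simp: R_def)
  qed
  then obtain u where u: "u \<in> Field R" "\<forall>q\<in>Field R. (u, q) \<in> R \<longrightarrow> q = u"
    using Zorns_po_lemma[OF po] by blast
  have "linear u"
  proof (rule minimal_sublinear_imp_linear)
    show "sublinear u" using u(1) by (simp add: field A_def)
    show "q = u" if "sublinear q" "q \<le> u" for q
      using that u unfolding field by (force simp: R_def A_def intro: order_trans)
  qed
  moreover have "u \<le> p" using u(1) by (simp add: field A_def)
  ultimately show ?thesis by (rule that)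
qed

text \<open>A linear functional that is only required to lie below the norm may vanish at \<open>x\<close>. The norm is
  therefore first decreased so that its value at \<open>- x\<close> drops to \<open>- norm x\<close>; any linear functional below
  the result is at least \<open>norm x\<close> at \<open>x\<close>.\<close>

lemma exists_real_norming_functional:
  fixes x :: "'a::real_normed_vector"
  obtains u where "linear u" "\<And>z. u z \<le> norm z" "norm x \<le> u x"
proof -
  obtain q where q: "sublinear q" "q \<le> norm" "q (- x) \<le> - norm x"
    using sublinear_decrease[OF sublinear_norm] .
  obtain u where u: "linear u" "u \<le> q"
    using exists_linear_below_sublinear[OF q(1)] .
  have "u (- x) \<le> - norm x" using q(3) u(2) by (force simp: le_fun_def intro: order_trans)
  then have "norm x \<le> u x" by (simp add: linear_neg[OF u(1)])
  moreover have "u z \<le> norm z" for z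
    using le_funD[OF u(2), of z] le_funD[OF q(2), of z] by simp
  ultimately show ?thesis using u(1) that by blast
qed

section \<open>The duality pairing\<close>

lemma pairing_add_left: "pairing (x + y) f = pairing x f + pairing y f"
  and pairing_diff_left: "pairing (x - y) f = pairing x f - pairing y f"
  and pairing_minus_left: "pairing (- x) f = - pairing x f"
  and pairing_scaleR_left: "pairing (r *\<^sub>R x) f = r *\<^sub>R pairing x f"
  by (simp_all add: pairing_def blinfun.add_right blinfun.diff_right blinfun.minus_right
      blinfun.scaleR_right)

lemma pairing_scaleC_left: "pairing (c *\<^sub>C x) f = c * pairing x f"
  using blinfun_of_dual[of f] by (simp add: pairing_def)

lemma pairing_add_right: "pairing x (f + g) = pairing x f + pairing x g"
  and pairing_diff_right: "pairing x (f - g) = pairing x f - pairing x g"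
  and pairing_minus_right: "pairing x (- f) = - pairing x f"
  and pairing_scaleC_right: "pairing x (c *\<^sub>C f) = c * pairing x f"
  by (simp_all add: pairing_def plus_dual.rep_eq minus_dual.rep_eq uminus_dual.rep_eq
      scaleC_dual.rep_eq blinfun.add_left blinfun.diff_left blinfun.minus_left)

lemma norm_pairing_le: "cmod (pairing x f) \<le> norm f * norm x"
  by (simp add: pairing_def norm_dual.rep_eq norm_blinfun)

lemma tendsto_pairing_left:
  "(x \<longlongrightarrow> l) F \<Longrightarrow> ((\<lambda>n. pairing (x n) f) \<longlongrightarrow> pairing l f) F"
  unfolding pairing_def by (intro tendsto_intros)

lemma dual_norm_le:
  assumes "0 \<le> K" "\<And>x. cmod (pairing x f) \<le> K * norm x"
  shows "norm f \<le> K"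
  using assms by (simp add: norm_dual.rep_eq pairing_def norm_blinfun_bound)

lemma dual_eqI: "(\<And>x. pairing x f = pairing x g) \<Longrightarrow> f = g"
  by (metis blinfun_eqI blinfun_of_dual_inject pairing_def)

lemma dual_of_function:
  assumes add: "\<And>x y. f (x + y) = f x + f y"
    and scale: "\<And>c x. f (c *\<^sub>C x) = c * f x"
    and bound: "\<And>x. cmod (f x) \<le> K * norm x"
  obtains f' where "\<And>x. pairing x f' = f x"
proof -
  have "f (r *\<^sub>R x) = r *\<^sub>R f x" for r x
    by (simp only: scaleR_scaleC[of r x] scale scaleR_conv_of_real)
  then have "bounded_linear f"
    using add bound by (intro bounded_linear_intro[of f K]) (simp_all add: mult.commute)
  then have "blinfun_apply (blinfun_of_dual (Abs_dual (Blinfun f))) = f"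
    by (simp add: Abs_dual_inverse bounded_linear_Blinfun_apply scale)
  then show ?thesis by (intro that[of "Abs_dual (Blinfun f)"]) (simp add: pairing_def)
qed

lemma mult_cnj_sgn: "cnj (sgn w) * w = of_real (cmod w)"
  by (cases "w = 0")
    (simp_all add: sgn_eq complex_norm_square[symmetric] power2_eq_square mult.commute)

lemma norm_cnj_sgn_le: "cmod (cnj (sgn w)) \<le> 1"
  by (simp add: norm_sgn)

text \<open>Real parts suffice, since every \<open>x\<close> can be rotated to make \<open>pairing x f\<close> equal to its modulus.\<close>

lemma dual_norm_le_Re:
  assumes "\<And>x. norm x \<le> 1 \<Longrightarrow> Re (pairing x f) \<le> r"
  shows "norm f \<le> r"
proof (rule dual_norm_le)
  have "Re (pairing 0 f) = 0" by (simp add: pairing_def)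
  with assms[of 0] show "0 \<le> r" by simp
next
  fix x
  show "cmod (pairing x f) \<le> r * norm x"
  proof (cases "x = 0")
    case False
    define y where "y = inverse (norm x) *\<^sub>R cnj (sgn (pairing x f)) *\<^sub>C x"
    have "norm y \<le> 1"
      using False by (simp add: y_def norm_scaleC norm_sgn)
    then have "Re (pairing y f) \<le> r" by (rule assms)
    moreover have "Re (pairing y f) = cmod (pairing x f) / norm x"
      unfolding y_def pairing_scaleR_left pairing_scaleC_left mult_cnj_sgn
      by (simp add: divide_inverse mult.commute)
    ultimately show ?thesis using False by (simp add: field_simps)
  qed (simp add: pairing_def)
qed

section \<open>The canonical embedding into the bidual\<close>

text \<open>Choosing the element by its values avoids unfolding the two layers of the dual type;
  \<open>pairing_canonical\<close> shows that such an element exists, and \<open>dual_eqI\<close> that it is unique.\<close>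

definition canonical :: "'a::complex_normed_vector \<Rightarrow> 'a dual dual" where
  "canonical x = (SOME g. \<forall>f. pairing f g = pairing x f)"

lemma pairing_canonical: "pairing f (canonical x) = pairing x f"
proof -
  obtain g :: "'a dual dual" where "\<And>f. pairing f g = pairing x f"
    using dual_of_function[of "\<lambda>f. pairing x f" "norm x"] norm_pairing_le[of x]
    by (auto simp: pairing_add_right pairing_scaleC_right mult.commute)
  then have "\<exists>g :: 'a dual dual. \<forall>f. pairing f g = pairing x f" by blast
  from someI_ex[OF this] show ?thesis by (simp add: canonical_def)
qed

lemma canonical_diff: "canonical (x - y) = canonical x - canonical y"
  by (rule dual_eqI) (simp add: pairing_canonical pairing_diff_right pairing_diff_left)

lemma norm_canonical_le: "norm (canonical x) \<le> norm x"
  using norm_pairing_le[of x]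
  by (intro dual_norm_le) (simp_all add: pairing_canonical mult.commute)

text \<open>A real-linear \<open>u\<close> below the norm is the real part of the complex-linear functional
  \<open>z \<mapsto> u z - \<i> u (\<i> z)\<close>, whose modulus is bounded by the norm after a rotation of the argument.\<close>

lemma exists_norming_functional:
  fixes x :: "'a::complex_normed_vector"
  obtains f :: "'a dual" where "norm f \<le> 1" "norm x \<le> cmod (pairing x f)"
proof -
  obtain u :: "'a \<Rightarrow> real" where u: "linear u" "\<And>z. u z \<le> norm z" "norm x \<le> u x"
    using exists_real_norming_functional[of x] by blast
  define h where "h z = Complex (u z) (- u (\<i> *\<^sub>C z))" for z
  have scaleC: "c *\<^sub>C z = Re c *\<^sub>R z + Im c *\<^sub>R \<i> *\<^sub>C z" for c and z :: 'a
    by (simp add: scaleR_scaleC scaleC_scaleC scaleC_add_left[symmetric] complex_eq[symmetric]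
        mult.commute[of _ \<i>])
  have i: "\<i> *\<^sub>C c *\<^sub>C z = Re c *\<^sub>R \<i> *\<^sub>C z - Im c *\<^sub>R z" for c and z :: 'a
    using scaleC[of "\<i> * c" z] by (simp add: scaleC_scaleC)
  have h_add: "h (y + z) = h y + h z" for y z
    by (simp add: h_def scaleC_add_right linear_add[OF u(1)] complex_eq_iff)
  have h_scale: "h (c *\<^sub>C z) = c * h z" for c z
  proof -
    have "u (c *\<^sub>C z) = Re c * u z + Im c * u (\<i> *\<^sub>C z)"
      by (subst scaleC) (simp add: linear_add[OF u(1)] linear_cmul[OF u(1)])
    moreover have "u (\<i> *\<^sub>C c *\<^sub>C z) = Re c * u (\<i> *\<^sub>C z) - Im c * u z"
      by (simp add: i linear_diff[OF u(1)] linear_cmul[OF u(1)])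
    ultimately show ?thesis by (simp add: h_def complex_eq_iff)
  qed
  have h_bound: "cmod (h z) \<le> 1 * norm z" for z
  proof -
    define c where "c = cnj (sgn (h z))"
    have "cmod (h z) = Re (h (c *\<^sub>C z))" 
      unfolding h_scale c_def mult_cnj_sgn by simp
    also have "\<dots> \<le> norm (c *\<^sub>C z)" by (simp add: h_def u(2))
    also have "\<dots> \<le> 1 * norm z"
      unfolding norm_scaleC c_def by (intro mult_right_mono norm_cnj_sgn_le) simp
    finally show ?thesis .
  qed
  obtain f where f: "\<And>z. pairing z f = h z"
    using dual_of_function[of h 1, OF h_add h_scale h_bound] by blast
  have "norm f \<le> 1"
    by (rule dual_norm_le) (use h_bound in \<open>simp_all add: f\<close>)
  moreover have "norm x \<le> cmod (pairing x f)"
    using u(3) complex_Re_le_cmod[of "h x"] by (simp add: f h_def)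
  ultimately show ?thesis by (rule that)
qed

lemma norm_canonical: "norm (canonical x) = norm x"
proof (rule antisym[OF norm_canonical_le])
  obtain f where f: "norm f \<le> 1" "norm x \<le> cmod (pairing x f)"
    by (rule exists_norming_functional)
  note f(2)
  also have "cmod (pairing x f) \<le> norm (canonical x) * norm f"
    using norm_pairing_le[of f "canonical x"] by (simp add: pairing_canonical)
  also have "\<dots> \<le> norm (canonical x)"
    using f(1) by (simp add: mult_left_le)
  finally show "norm x \<le> norm (canonical x)" .
qed

text \<open>If the point \<open>(g f1, g f2)\<close> were not in the closure of the image of the unit ball under
  \<open>(f1, f2)\<close>, a real hyperplane in \<open>\<complex>\<^sup>2\<close> would separate them. Its normal vector gives a
  combination \<open>h\<close> of \<open>f1\<close> and \<open>f2\<close> with \<open>Re (g h) > norm h\<close>, against \<open>norm g \<le> 1\<close>.\<close>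

lemma goldstine_two_functionals:
  fixes f1 f2 :: "'a::complex_normed_vector dual"
  assumes g: "norm g \<le> 1" and \<eta>: "0 < \<eta>"
  obtains z where "norm z \<le> 1" "cmod (pairing z f1 - pairing f1 g) < \<eta>"
    "cmod (pairing z f2 - pairing f2 g) < \<eta>"
proof -
  define T where "T z = (pairing z f1, pairing z f2)" for z
  define K where "K = T ` cball 0 1"
  define w where "w = (pairing f1 g, pairing f2 g)"
  have "linear T"
    by (rule linearI) (simp_all add: T_def pairing_add_left pairing_scaleR_left)
  then have "convex K" unfolding K_def by (intro convex_linear_image) auto
  have "w \<in> closure K"
  proof (rule ccontr)
    assume "w \<notin> closure K"
    then obtain a b where ab: "inner a w < b" "\<forall>k\<in>closure K. b < inner a k"
      using separating_hyperplane_closed_point[of "closure K" w] \<open>convex K\<close>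
      by (auto simp: convex_closure)
    \<comment> \<open>The real inner product on \<open>\<complex>\<^sup>2\<close> is the real part of the sesquilinear one, hence the conjugates;
      the sign turns the lower bound \<open>b\<close> on the image of the ball into an upper bound.\<close>
    define h where "h = - (cnj (fst a) *\<^sub>C f1 + cnj (snd a) *\<^sub>C f2)"
    have "norm h \<le> - b"
    proof (rule dual_norm_le_Re)
      fix z :: 'a assume "norm z \<le> 1"
      then have "T z \<in> closure K"
        by (intro closure_subset[THEN subsetD]) (auto simp: K_def)
      with ab(2) have "b < inner a (T z)" by blast
      then show "Re (pairing z h) \<le> - b"
        by (simp add: h_def T_def pairing_minus_right pairing_diff_right pairing_scaleC_right
            inner_prod_def inner_complex_def)
    qed
    moreover have "- b < Re (pairing h g)"
    proof -
      have "pairing h g = - (cnj (fst a) * pairing f1 g + cnj (snd a) * pairing f2 g)"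
        unfolding h_def by (simp only: pairing_minus_left pairing_add_left pairing_scaleC_left)
      with ab(1) show ?thesis
        by (simp add: w_def inner_prod_def inner_complex_def)
    qed
    moreover have "Re (pairing h g) \<le> norm h"
    proof -
      have "cmod (pairing h g) \<le> norm g * norm h" by (rule norm_pairing_le)
      also have "\<dots> \<le> 1 * norm h" using g by (intro mult_right_mono) auto
      finally show ?thesis using complex_Re_le_cmod[of "pairing h g"] by simp
    qed
    ultimately show False by simp
  qed
  then obtain z where z: "norm z \<le> 1" "dist (T z) w < \<eta>"
    using \<eta> by (auto simp: closure_approachable K_def)
  show ?thesis
  proof (rule that[OF z(1)])
    show "cmod (pairing z f1 - pairing f1 g) < \<eta>"
      using dist_fst_le[of "T z" w] z(2) by (simp add: T_def w_def dist_norm)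
    show "cmod (pairing z f2 - pairing f2 g) < \<eta>"
      using dist_snd_le[of "T z" w] z(2) by (simp add: T_def w_def dist_norm)
  qed
qed

section \<open>Uniform smoothness of the dual\<close>

text \<open>The hypothesis on \<open>\<phi>\<close> cannot be applied to \<open>x n\<close> itself, because \<open>pairing (x n) a\<close> need not be
  real. The factors \<open>u n\<close> make it real and tend to \<open>1\<close>, so they do not affect the limit.\<close>

lemma canonical_tendsto_smooth_point:
  fixes x :: "nat \<Rightarrow> 'a::complex_normed_vector"
  assumes smooth: "\<And>\<epsilon>. 0 < \<epsilon> \<Longrightarrow> \<exists>\<delta>>0. \<forall>g \<in> cball (0 :: 'a dual dual) 1.
      pairing a g \<in> \<real> \<and> Re (pairing a g) > 1 - \<delta> \<longrightarrow> norm (\<phi> - g) < \<epsilon>"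
    and x: "\<And>n. norm (x n) = 1" and lim: "(\<lambda>n. pairing (x n) a) \<longlonglongrightarrow> 1"
  shows "(\<lambda>n. canonical (x n)) \<longlonglongrightarrow> \<phi>"
proof -
  define u where "u n = cnj (sgn (pairing (x n) a))" for n
  have "(\<lambda>n. cnj (sgn (pairing (x n) a))) \<longlonglongrightarrow> cnj (sgn 1)"
    by (intro tendsto_intros lim) simp
  then have u: "u \<longlonglongrightarrow> 1" by (simp add: u_def[abs_def])
  have rotated: "(\<lambda>n. canonical (u n *\<^sub>C x n)) \<longlonglongrightarrow> \<phi>"
  proof (rule tendstoI)
    fix \<epsilon> :: real assume "0 < \<epsilon>"
    then obtain \<delta> where \<delta>: "0 < \<delta>" "\<forall>g \<in> cball (0 :: 'a dual dual) 1.
        pairing a g \<in> \<real> \<and> Re (pairing a g) > 1 - \<delta> \<longrightarrow> norm (\<phi> - g) < \<epsilon>"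
      using smooth by blast
    have "(\<lambda>n. cmod (pairing (x n) a)) \<longlonglongrightarrow> 1"
      using tendsto_norm[OF lim] by simp
    then have "\<forall>\<^sub>F n in sequentially. 1 - \<delta> < cmod (pairing (x n) a)"
      using \<delta>(1) by (intro order_tendstoD) auto
    then show "\<forall>\<^sub>F n in sequentially. dist (canonical (u n *\<^sub>C x n)) \<phi> < \<epsilon>"
    proof eventually_elim
      case (elim n)
      have "norm (u n *\<^sub>C x n) \<le> 1"
        unfolding norm_scaleC x u_def using norm_cnj_sgn_le by simp
      then have "canonical (u n *\<^sub>C x n) \<in> cball 0 1"
        using norm_canonical_le[of "u n *\<^sub>C x n"] by simp
      moreover have "pairing a (canonical (u n *\<^sub>C x n)) = of_real (cmod (pairing (x n) a))"
        unfolding pairing_canonical pairing_scaleC_left u_def by (rule mult_cnj_sgn)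
      ultimately have "norm (\<phi> - canonical (u n *\<^sub>C x n)) < \<epsilon>"
        using \<delta>(2) elim by auto
      then show ?case by (simp add: dist_norm norm_minus_commute)
    qed
  qed
  have "(\<lambda>n. canonical (x n) - canonical (u n *\<^sub>C x n)) \<longlonglongrightarrow> 0"
  proof (rule Lim_null_comparison)
    have "norm (canonical (x n) - canonical (u n *\<^sub>C x n)) \<le> cmod (1 - u n)" for n
    proof -
      have "x n - u n *\<^sub>C x n = (1 - u n) *\<^sub>C x n"
        using scaleC_add_left[of "1 - u n" "u n" "x n"] scaleR_scaleC[of 1 "x n"]
        by (simp add: algebra_simps)
      then show ?thesis
        using norm_canonical_le[of "x n - u n *\<^sub>C x n"] 
        by (simp add: canonical_diff[symmetric] norm_scaleC x)
    qed
    then show "\<forall>\<^sub>F n in sequentially.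
        norm (canonical (x n) - canonical (u n *\<^sub>C x n)) \<le> cmod (1 - u n)" by simp
    show "(\<lambda>n. cmod (1 - u n)) \<longlonglongrightarrow> 0"
      using tendsto_norm[OF tendsto_diff[OF tendsto_const[of 1] u]] by simp
  qed
  from tendsto_add[OF this rotated] show ?thesis by simp
qed

text \<open>The sequential condition of the theorem for a single functional \<open>a\<close>. Fixing \<open>a\<close> shows that the
  implication from sequences to smoothness holds point by point.\<close>

definition sequentially_rotund_at :: "'a::complex_normed_vector dual \<Rightarrow> bool" where
  "sequentially_rotund_at a \<longleftrightarrow> (\<forall>x y :: nat \<Rightarrow> 'a.
     (\<forall>n. norm (x n) = 1) \<longrightarrow> (\<forall>n. norm (y n) = 1) \<longrightarrow>
     (\<lambda>n. pairing (x n) a) \<longlonglongrightarrow> 1 \<longrightarrow> (\<lambda>n. pairing (y n) a) \<longlonglongrightarrow> 1 \<longrightarrow>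
     (\<lambda>n. norm (x n - y n)) \<longlonglongrightarrow> 0)"

text \<open>In the closed unit disc, \<open>\<bar>p - 1\<bar>\<^sup>2 \<le> 2 (1 - Re p)\<close>.\<close>

lemma tendsto_1_of_Re:
  fixes p :: "nat \<Rightarrow> complex"
  assumes le: "\<And>n. cmod (p n) \<le> 1" and Re: "(\<lambda>n. Re (p n)) \<longlonglongrightarrow> 1"
  shows "p \<longlonglongrightarrow> 1"
proof -
  have "(\<lambda>n. (cmod (p n - 1))\<^sup>2) \<longlonglongrightarrow> 0"
  proof (rule Lim_null_comparison)
    have "(cmod (p n - 1))\<^sup>2 \<le> 2 * (1 - Re (p n))" for n
    proof -
      have "(cmod (p n))\<^sup>2 \<le> 1" using le[of n] by (simp add: power_le_one)
      then show ?thesis by (simp add: cmod_power2 power2_diff)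
    qed
    then show "\<forall>\<^sub>F n in sequentially. norm ((cmod (p n - 1))\<^sup>2) \<le> 2 * (1 - Re (p n))" by simp
    show "(\<lambda>n. 2 * (1 - Re (p n))) \<longlonglongrightarrow> 0"
      using tendsto_mult[OF tendsto_const[of 2] tendsto_diff[OF tendsto_const[of 1] Re]] by simp
  qed
  then have "(\<lambda>n. cmod (p n - 1)) \<longlonglongrightarrow> 0"
    using tendsto_real_sqrt by fastforce
  then show ?thesis by (simp add: LIM_zero_iff tendsto_norm_zero_iff)
qed

text \<open>The sequential condition concerns unit vectors, whereas slices consist of vectors in the ball.
  Normalising is harmless, since \<open>Re (pairing z a) \<le> norm z \<le> 1\<close> forces the norms to tend to \<open>1\<close>.\<close>

lemma normalize_tendsto:
  fixes z :: "nat \<Rightarrow> 'a::complex_normed_vector"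
  assumes a: "norm a = 1" and z: "\<And>n. norm (z n) \<le> 1" "\<And>n. z n \<noteq> 0"
    and lim: "(\<lambda>n. Re (pairing (z n) a)) \<longlonglongrightarrow> 1"
  shows "(\<lambda>n. pairing (sgn (z n)) a) \<longlonglongrightarrow> 1" "(\<lambda>n. norm (sgn (z n) - z n)) \<longlonglongrightarrow> 0"
proof -
  have le: "cmod (pairing (z n) a) \<le> norm (z n)" for n
    using norm_pairing_le[of "z n" a] a by simp
  have norm: "(\<lambda>n. norm (z n)) \<longlonglongrightarrow> 1"
  proof (rule tendsto_sandwich[OF _ _ lim tendsto_const])
    show "\<forall>\<^sub>F n in sequentially. Re (pairing (z n) a) \<le> norm (z n)"
      using le complex_Re_le_cmod order_trans by (intro always_eventually) blast
  qed (simp add: z)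
  have "(\<lambda>n. pairing (z n) a) \<longlonglongrightarrow> 1"
    using le z(1) order_trans by (intro tendsto_1_of_Re lim) blast
  from tendsto_scaleR[OF tendsto_inverse[OF norm] this]
  show "(\<lambda>n. pairing (sgn (z n)) a) \<longlonglongrightarrow> 1"
    by (simp add: sgn_div_norm pairing_scaleR_left)
  have "norm (sgn (z n) - z n) = 1 - norm (z n)" for n
  proof -
    have "sgn (z n) - z n = (1 - norm (z n)) *\<^sub>R sgn (z n)"
      using z(2)[of n] by (simp add: sgn_div_norm algebra_simps)
    then show ?thesis using z[of n] by (simp add: norm_sgn)
  qed
  then show "(\<lambda>n. norm (sgn (z n) - z n)) \<longlonglongrightarrow> 0"
    using tendsto_diff[OF tendsto_const[of 1] norm] by simp
qed

text \<open>If the slices did not shrink, pairs of points at distance at least \<open>\<epsilon>\<close>, taken from slices of depth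
  \<open>1 / (n + 1)\<close> and normalised, would contradict the sequential condition.\<close>

lemma small_slices:
  fixes a :: "'a::complex_normed_vector dual"
  assumes rot: "sequentially_rotund_at a" and a: "norm a = 1" and \<epsilon>: "0 < \<epsilon>"
  obtains \<delta> where "0 < \<delta>" "\<And>z w. \<lbrakk>norm z \<le> 1; norm w \<le> 1; Re (pairing z a) > 1 - \<delta>;
      Re (pairing w a) > 1 - \<delta>\<rbrakk> \<Longrightarrow> norm (z - w) < \<epsilon>"
proof (rule ccontr)
  assume "\<not> thesis"
  with that have "\<exists>z w. norm z \<le> 1 \<and> norm w \<le> 1 \<and> Re (pairing z a) > 1 - \<delta> \<and>
      Re (pairing w a) > 1 - \<delta> \<and> \<epsilon> \<le> norm (z - w)" if "0 < \<delta>" for \<delta>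
    using that by (meson not_less)
  then have "\<forall>n. \<exists>z w. norm z \<le> 1 \<and> norm w \<le> 1 \<and> Re (pairing z a) > 1 - inverse (real (Suc n)) \<and>
      Re (pairing w a) > 1 - inverse (real (Suc n)) \<and> \<epsilon> \<le> norm (z - w)"
    by simp
  then obtain z w where zw: "\<And>n. norm (z n) \<le> 1" "\<And>n. norm (w n) \<le> 1"
    "\<And>n. Re (pairing (z n) a) > 1 - inverse (real (Suc n))"
    "\<And>n. Re (pairing (w n) a) > 1 - inverse (real (Suc n))" "\<And>n. \<epsilon> \<le> norm (z n - w n)"
    by metis
  have lim: "(\<lambda>n. Re (pairing (v n) a)) \<longlonglongrightarrow> 1" and ne: "v n \<noteq> 0"
    if v: "\<And>n. norm (v n) \<le> 1" "\<And>n. Re (pairing (v n) a) > 1 - inverse (real (Suc n))" for v n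
  proof -
    have lower: "(\<lambda>n. 1 - inverse (real (Suc n))) \<longlonglongrightarrow> 1"
      using tendsto_diff[OF tendsto_const[of 1] LIMSEQ_inverse_real_of_nat] by simp
    have le: "Re (pairing (v n) a) \<le> 1" for n
      using norm_pairing_le[of "v n" a] complex_Re_le_cmod[of "pairing (v n) a"] v(1)[of n] a
      by simp
    show "(\<lambda>n. Re (pairing (v n) a)) \<longlonglongrightarrow> 1"
    proof (rule tendsto_sandwich[OF _ _ lower tendsto_const])
      show "\<forall>\<^sub>F n in sequentially. 1 - inverse (real (Suc n)) \<le> Re (pairing (v n) a)"
        by (intro always_eventually allI less_imp_le v(2))
    qed (simp add: le)
    \<comment> \<open>The depths do not exceed \<open>1\<close>, so the origin lies in none of the slices.\<close>
    have "inverse (real (Suc n)) \<le> 1" by (simp add: inverse_le_1_iff)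
    with v(2)[of n] show "v n \<noteq> 0" by (auto simp: pairing_def)
  qed
  note nz = normalize_tendsto[OF a zw(1) ne[OF zw(1,3)] lim[OF zw(1,3)]]
  note nw = normalize_tendsto[OF a zw(2) ne[OF zw(2,4)] lim[OF zw(2,4)]]
  have "(\<lambda>n. norm (sgn (z n) - sgn (w n))) \<longlonglongrightarrow> 0"
    using rot nz(1) nw(1) ne[OF zw(1,3)] ne[OF zw(2,4)]
    unfolding sequentially_rotund_at_def by (simp add: norm_sgn)
  then have "(\<lambda>n. (sgn (z n) - sgn (w n)) - (sgn (z n) - z n) + (sgn (w n) - w n)) \<longlonglongrightarrow> 0 - 0 + 0"
    using nz(2) nw(2) by (intro tendsto_add tendsto_diff) (simp_all only: tendsto_norm_zero_iff)
  then have "(\<lambda>n. norm (z n - w n)) \<longlonglongrightarrow> 0"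
    by (simp add: tendsto_norm_zero_iff)
  then have "\<epsilon> \<le> 0" using zw(5) by (intro LIMSEQ_le_const) auto
  with \<epsilon> show False by simp
qed

text \<open>Points chosen from smaller and smaller slices form a Cauchy sequence by \<open>small_slices\<close>. This is
  where the completeness of the space enters.\<close>

lemma norm_attained:
  fixes a :: "'a::complex_banach dual"
  assumes rot: "sequentially_rotund_at a" and a: "norm a = 1"
  obtains x where "norm x \<le> 1" "pairing x a = 1"
proof -
  have "\<exists>z. norm z \<le> 1 \<and> 1 - inverse (real (Suc n)) < Re (pairing z a)" for n
  proof (rule ccontr)
    assume "\<not> ?thesis"
    then have "norm a \<le> 1 - inverse (real (Suc n))"
      by (intro dual_norm_le_Re) (auto simp: not_less)
    with a show False by simp
  qed
  then obtain z where z: "\<And>n. norm (z n) \<le> 1"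
    "\<And>n. 1 - inverse (real (Suc n)) < Re (pairing (z n) a)" by metis
  have lower: "(\<lambda>n. 1 - inverse (real (Suc n))) \<longlonglongrightarrow> 1"
    using tendsto_diff[OF tendsto_const[of 1] LIMSEQ_inverse_real_of_nat] by simp
  have le: "cmod (pairing (z n) a) \<le> 1" for n
    using norm_pairing_le[of "z n" a] z(1)[of n] a by simp
  have lim: "(\<lambda>n. Re (pairing (z n) a)) \<longlonglongrightarrow> 1"
  proof (rule tendsto_sandwich[OF _ _ lower tendsto_const])
    show "\<forall>\<^sub>F n in sequentially. Re (pairing (z n) a) \<le> 1"
      using le complex_Re_le_cmod order_trans by (intro always_eventually) blast
    show "\<forall>\<^sub>F n in sequentially. 1 - inverse (real (Suc n)) \<le> Re (pairing (z n) a)"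
      by (intro always_eventually allI less_imp_le z(2))
  qed
  have "Cauchy z"
  proof (rule metric_CauchyI)
    fix \<epsilon> :: real assume "0 < \<epsilon>"
    then obtain \<delta> where \<delta>: "0 < \<delta>" "\<And>z w. \<lbrakk>norm z \<le> 1; norm w \<le> 1; Re (pairing z a) > 1 - \<delta>;
        Re (pairing w a) > 1 - \<delta>\<rbrakk> \<Longrightarrow> norm (z - w) < \<epsilon>"
      using small_slices[OF rot a] by blast
    have "\<forall>\<^sub>F n in sequentially. 1 - \<delta> < Re (pairing (z n) a)"
      using lim \<delta>(1) by (intro order_tendstoD) auto
    then obtain N where "\<forall>n\<ge>N. 1 - \<delta> < Re (pairing (z n) a)"
      by (auto simp: eventually_sequentially)
    with \<delta>(2) z(1) show "\<exists>N. \<forall>m\<ge>N. \<forall>n\<ge>N. dist (z m) (z n) < \<epsilon>"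
      unfolding dist_norm by blast
  qed
  then obtain x where x: "z \<longlonglongrightarrow> x"
    by (auto simp: Cauchy_convergent_iff convergent_def)
  have "norm x \<le> 1"
    using tendsto_norm[OF x] z(1) by (intro LIMSEQ_le_const2) auto
  moreover have "pairing x a = 1"
    using tendsto_pairing_left[OF x] tendsto_1_of_Re[OF le lim] by (rule LIMSEQ_unique)
  ultimately show ?thesis by (rule that)
qed

text \<open>A point \<open>z\<close> of the ball that is close to \<open>g\<close> at both \<open>a\<close> and \<open>f\<close> lies in the slice, hence near \<open>x\<close>;
  so \<open>g\<close> and the image of \<open>x\<close> nearly agree at \<open>f\<close>. The point \<open>z\<close> depends on \<open>f\<close>, but the bound
  does not.\<close>

lemma bidual_slice_small:
  fixes a :: "'a::complex_normed_vector dual"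
  assumes slice: "\<And>z. norm z \<le> 1 \<Longrightarrow> Re (pairing z a) > 1 - \<delta> \<Longrightarrow> norm (x - z) < \<epsilon>"
    and g: "norm g \<le> 1" "Re (pairing a g) > 1 - \<delta>"
  shows "norm (canonical x - g) \<le> \<epsilon>"
proof (rule dual_norm_le_Re)
  fix f :: "'a dual" assume f: "norm f \<le> 1"
  have "Re (pairing f (canonical x - g)) \<le> \<epsilon> + \<eta>" if "0 < \<eta>" for \<eta>
  proof -
    \<comment> \<open>The second entry of the minimum keeps the approximating point \<open>z\<close> inside the slice.\<close>
    define \<eta>' where "\<eta>' = min \<eta> (Re (pairing a g) - (1 - \<delta>))"
    have "0 < \<eta>'" using that g(2) by (simp add: \<eta>'_def)
    then obtain z where z: "norm z \<le> 1" "cmod (pairing z a - pairing a g) < \<eta>'"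
      "cmod (pairing z f - pairing f g) < \<eta>'"
      using goldstine_two_functionals[OF g(1)] by blast
    have "Re (pairing z a) > 1 - \<delta>"
      using z(2) complex_Re_le_cmod[of "pairing a g - pairing z a"]
      by (simp add: \<eta>'_def norm_minus_commute)
    then have "norm (x - z) < \<epsilon>" using z(1) slice by blast
    moreover have "cmod (pairing (x - z) f) \<le> norm (x - z)"
      using norm_pairing_le[of "x - z" f] f mult_right_mono[of "norm f" 1 "norm (x - z)"] by simp
    moreover have "pairing f (canonical x - g) = pairing (x - z) f + (pairing z f - pairing f g)"
      by (simp add: pairing_diff_right pairing_diff_left pairing_canonical)
    ultimately show ?thesis
      using z(3) complex_Re_le_cmod[of "pairing (x - z) f"]
        complex_Re_le_cmod[of "pairing z f - pairing f g"] by (simp add: \<eta>'_def)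
  qed
  then show "Re (pairing f (canonical x - g)) \<le> \<epsilon>" by (rule field_le_epsilon)
qed

text \<open>The point is the image of the vector at which \<open>a\<close> attains its norm. This image lies in every
  slice, so any other candidate is at distance less than every \<open>\<epsilon>\<close> from it.\<close>

lemma smooth_point_of_rotund:
  fixes a :: "'a::complex_banach dual"
  assumes rot: "sequentially_rotund_at a" and a: "norm a = 1"
  shows "\<exists>!\<phi>. \<phi> \<in> sphere (0 :: 'a dual dual) 1 \<and> (\<forall>\<epsilon>>0. \<exists>\<delta>>0. \<forall>g \<in> cball (0 :: 'a dual dual) 1.
     pairing a g \<in> \<real> \<and> Re (pairing a g) > 1 - \<delta> \<longrightarrow> norm (\<phi> - g) < \<epsilon>)"
proof -
  obtain x where x: "norm x \<le> 1" "pairing x a = 1"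
    using norm_attained[OF rot a] .
  have le: "norm (canonical x) \<le> 1"
    using norm_canonical_le[of x] x(1) by simp
  show ?thesis
  proof (rule ex1I[of _ "canonical x"], intro conjI allI impI)
    have "1 \<le> norm (canonical x)"
      using norm_pairing_le[of a "canonical x"] a x(2) by (simp add: pairing_canonical)
    with le show "canonical x \<in> sphere 0 1" by simp
  next
    fix \<epsilon> :: real assume "0 < \<epsilon>"
    then have "0 < \<epsilon> / 2" by simp
    then obtain \<delta> where \<delta>: "0 < \<delta>" "\<And>z w. \<lbrakk>norm z \<le> 1; norm w \<le> 1; Re (pairing z a) > 1 - \<delta>;
        Re (pairing w a) > 1 - \<delta>\<rbrakk> \<Longrightarrow> norm (z - w) < \<epsilon> / 2"
      using small_slices[OF rot a] by blast
    have "norm (canonical x - g) < \<epsilon>" if "norm g \<le> 1" "Re (pairing a g) > 1 - \<delta>" for g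
    proof -
      have "norm (canonical x - g) \<le> \<epsilon> / 2"
        using x \<delta> by (intro bidual_slice_small[where a = a and \<delta> = \<delta>] that) auto
      with \<open>0 < \<epsilon>\<close> show ?thesis by simp
    qed
    with \<delta>(1) show "\<exists>\<delta>>0. \<forall>g \<in> cball (0 :: 'a dual dual) 1.
        pairing a g \<in> \<real> \<and> Re (pairing a g) > 1 - \<delta> \<longrightarrow> norm (canonical x - g) < \<epsilon>"
      by auto
  next
    fix \<phi> :: "'a dual dual"
    assume \<phi>: "\<phi> \<in> sphere 0 1 \<and> (\<forall>\<epsilon>>0. \<exists>\<delta>>0. \<forall>g \<in> cball (0 :: 'a dual dual) 1.
        pairing a g \<in> \<real> \<and> Re (pairing a g) > 1 - \<delta> \<longrightarrow> norm (\<phi> - g) < \<epsilon>)"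
    have "norm (\<phi> - canonical x) \<le> 0 + \<epsilon>" if \<epsilon>: "0 < \<epsilon>" for \<epsilon>
    proof -
      obtain \<delta> where "0 < \<delta>" "\<forall>g \<in> cball (0 :: 'a dual dual) 1.
          pairing a g \<in> \<real> \<and> Re (pairing a g) > 1 - \<delta> \<longrightarrow> norm (\<phi> - g) < \<epsilon>"
        using \<phi> \<epsilon> by blast
      with le x(2) show ?thesis by (auto simp: pairing_canonical intro: less_imp_le)
    qed
    then have "norm (\<phi> - canonical x) \<le> 0" by (rule field_le_epsilon)
    then show "\<phi> = canonical x" by simp
  qed
qed

theorem theorem1p5:
  shows "uniformly_smooth TYPE('a::complex_banach dual) \<longleftrightarrow>
    (\<forall>(x :: nat \<Rightarrow> 'a) (y :: nat \<Rightarrow> 'a) (a :: 'a dual).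
       (\<forall>n. x n \<in> sphere 0 1) \<longrightarrow> (\<forall>n. y n \<in> sphere 0 1) \<longrightarrow> a \<in> sphere 0 1 \<longrightarrow>
       (\<lambda>n. pairing (x n) a) \<longlonglongrightarrow> 1 \<longrightarrow> (\<lambda>n. pairing (y n) a) \<longlonglongrightarrow> 1 \<longrightarrow>
       (\<lambda>n. norm (x n - y n)) \<longlonglongrightarrow> 0)"
    (is "?smooth \<longleftrightarrow> ?seq")
proof
  assume smooth: ?smooth
  show ?seq
  proof (intro allI impI)
    fix x y :: "nat \<Rightarrow> 'a" and a :: "'a dual"
    assume x: "\<forall>n. x n \<in> sphere 0 1" and y: "\<forall>n. y n \<in> sphere 0 1" and a: "a \<in> sphere 0 1"
      and lim: "(\<lambda>n. pairing (x n) a) \<longlonglongrightarrow> 1" "(\<lambda>n. pairing (y n) a) \<longlonglongrightarrow> 1"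
    obtain \<phi> :: "'a dual dual" where "\<forall>\<epsilon>>0. \<exists>\<delta>>0. \<forall>g \<in> cball (0 :: 'a dual dual) 1.
        pairing a g \<in> \<real> \<and> Re (pairing a g) > 1 - \<delta> \<longrightarrow> norm (\<phi> - g) < \<epsilon>"
      using smooth a unfolding uniformly_smooth_def by blast
    then have \<phi>: "\<And>\<epsilon>. 0 < \<epsilon> \<Longrightarrow> \<exists>\<delta>>0. \<forall>g \<in> cball (0 :: 'a dual dual) 1.
        pairing a g \<in> \<real> \<and> Re (pairing a g) > 1 - \<delta> \<longrightarrow> norm (\<phi> - g) < \<epsilon>"
      by blast
    have "(\<lambda>n. canonical (x n)) \<longlonglongrightarrow> \<phi>" "(\<lambda>n. canonical (y n)) \<longlonglongrightarrow> \<phi>"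
      using x y lim by (auto intro: canonical_tendsto_smooth_point[OF \<phi>])
    then have "(\<lambda>n. canonical (x n) - canonical (y n)) \<longlonglongrightarrow> \<phi> - \<phi>" by (rule tendsto_diff)
    then have "(\<lambda>n. norm (canonical (x n - y n))) \<longlonglongrightarrow> 0"
      by (simp add: canonical_diff tendsto_norm_zero)
    then show "(\<lambda>n. norm (x n - y n)) \<longlonglongrightarrow> 0" by (simp add: norm_canonical)
  qed
next
  assume seq: ?seq
  have "sequentially_rotund_at a" if "norm a = 1" for a :: "'a dual"
    using seq that by (simp add: sequentially_rotund_at_def)
  then show ?smooth
    unfolding uniformly_smooth_def by (intro ballI smooth_point_of_rotund) auto
qed

end
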